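(* The following is a complete list of the (nonzero, proper) real Lie subalgebras of $\mathfrak{su}(3)$ up to conjugation in $\mathrm{SU}(3)$: (1) (dimension 1) $\mathfrak{w}_1^\lambda=\langle B_7+\lambda B_8\rangle$, $\lambda\in\mathbb{R}$, where $\mathfrak{w}_1^\lambda\sim\mathfrak{w}_1^\eta$ iff $\eta$ equals one of $\lambda,\;1-\lambda,\;\frac1\lambda,\;\frac{\lambda-1}{\lambda},\;\frac{\lambda}{\lambda-1},\;\frac1{1-\lambda}$ (expressions with zero denominator being disregarded); (2) (dimension 2) $\mathfrak{w}_2=\langle B_7,\;B_8\rangle$; (3) (dimension 3) $\mathfrak{w}_{3,1}=\langle B_3,\;B_4,\;B_7+B_8\rangle$; (4) (dimension 3) $\mathfrak{w}_{3,2}=\langle B_1+B_5,\;B_2+B_6,\;B_7+B_8\rangle$; (5) (dimension 4) $\mathfrak{w}_4=\langle B_3,\;B_4,\;B_7,\;B_8\rangle$. That is, every nonzero proper real subalgebra of $\mathfrak{su}(3)$ is conjugate under $\mathrm{SU}(3)$ to a subalgebra in this list, and subalgebras in the list are pairwise non-conjugate under $\mathrm{SU}(3)$ except for the conjugacies within the family (1) indicated above.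
   Context: $\mathfrak{su}(3)$ is the real Lie algebra of traceless skew-Hermitian complex $3\times3$ matrices and $\mathrm{SU}(3)$ is the group of unitary $3\times3$ matrices of determinant one. $\mathrm{SU}(3)$ acts on subalgebras by $g\cdot\mathfrak{w}=g\mathfrak{w}g^{-1}$; $\mathfrak{u}\sim\mathfrak{v}$ means that $\mathfrak{u}$ and $\mathfrak{v}$ lie in the same orbit. With $E_{ij}$ the matrix units, the real basis of $\mathfrak{su}(3)$ used is $B_1=i(E_{12}+E_{21})$, $B_2=E_{12}-E_{21}$, $B_3=i(E_{13}+E_{31})$, $B_4=E_{13}-E_{31}$, $B_5=i(E_{23}+E_{32})$, $B_6=E_{23}-E_{32}$, $B_7=i(E_{11}-E_{22})$, $B_8=i(E_{22}-E_{33})$. $\langle\cdots\rangle$ denotes the real linear span. *)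

theory Defs
  imports "HOL-Analysis.Analysis"
begin

type_synonym cmat3 = "complex^3^3"

definition adj :: "cmat3 \<Rightarrow> cmat3" where
  "adj A = (\<chi> i j. cnj (A $ j $ i))"

definition su3 :: "cmat3 set" where
  "su3 = {A. adj A = - A \<and> trace A = 0}"

definition SU3 :: "cmat3 set" where
  "SU3 = {g. g ** adj g = mat 1 \<and> adj g ** g = mat 1 \<and> det g = 1}"

definition lie_bracket :: "cmat3 \<Rightarrow> cmat3 \<Rightarrow> cmat3" where
  "lie_bracket A B = A ** B - B ** A"

text \<open>The constants \<open>subspace\<close>, \<open>span\<close> and \<open>dim\<close> refer to the real vector space structure of
  \<open>complex^3^3\<close>.\<close>

definition lie_subalgebra :: "cmat3 set \<Rightarrow> bool" where
  "lie_subalgebra w \<longleftrightarrow>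
     subspace w \<and> w \<subseteq> su3 \<and> (\<forall>A\<in>w. \<forall>B\<in>w. lie_bracket A B \<in> w)"

definition nonzero_proper_subalgebra :: "cmat3 set \<Rightarrow> bool" where
  "nonzero_proper_subalgebra w \<longleftrightarrow> lie_subalgebra w \<and> w \<noteq> {0} \<and> w \<noteq> su3"

definition act :: "cmat3 \<Rightarrow> cmat3 set \<Rightarrow> cmat3 set" where
  "act g w = (\<lambda>A. g ** A ** matrix_inv g) ` w"

definition conjugate :: "cmat3 set \<Rightarrow> cmat3 set \<Rightarrow> bool" (infix "\<sim>" 50) where
  "u \<sim> v \<longleftrightarrow> (\<exists>g\<in>SU3. v = act g u)"

definition E :: "3 \<Rightarrow> 3 \<Rightarrow> cmat3" where
  "E i j = (\<chi> k l. if k = i \<and> l = j then 1 else 0)"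

definition itimes :: "cmat3 \<Rightarrow> cmat3" where
  "itimes A = (\<chi> k l. \<i> * A $ k $ l)"

definition B1 :: cmat3 where "B1 = itimes (E 1 2 + E 2 1)"
definition B2 :: cmat3 where "B2 = E 1 2 - E 2 1"
definition B3 :: cmat3 where "B3 = itimes (E 1 3 + E 3 1)"
definition B4 :: cmat3 where "B4 = E 1 3 - E 3 1"
definition B5 :: cmat3 where "B5 = itimes (E 2 3 + E 3 2)"
definition B6 :: cmat3 where "B6 = E 2 3 - E 3 2"
definition B7 :: cmat3 where "B7 = itimes (E 1 1 - E 2 2)"
definition B8 :: cmat3 where "B8 = itimes (E 2 2 - E 3 3)"

definition w1 :: "real \<Rightarrow> cmat3 set" where "w1 l = span {B7 + l *\<^sub>R B8}"
definition w2 :: "cmat3 set" where "w2 = span {B7, B8}"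
definition w31 :: "cmat3 set" where "w31 = span {B3, B4, B7 + B8}"
definition w32 :: "cmat3 set" where "w32 = span {B1 + B5, B2 + B6, B7 + B8}"
definition w4 :: "cmat3 set" where "w4 = span {B3, B4, B7, B8}"

end

theory Submission
  imports Defs
begin

text \<open>
  Every element of \<open>su3\<close> is diagonalized by maximizing \<open>Im A\<^sub>1\<^sub>1 - Im
  A\<^sub>3\<^sub>3\<close> over its orbit: a nonzero off-diagonal entry could be rotated into a
  larger value, and the weights force the eigenvalues of a maximizer to be decreasing. Maximizing
  over the centralizer of a diagonal matrix diagonalizes two commuting elements simultaneously.

  Let \<open>w\<close> be a subalgebra. If \<open>w\<close> contains two independent commuting
  elements, it may be assumed to contain all diagonal matrices, and it is the sum of these and of
  root planes; two root planes generate the third one, which leaves \<open>w2\<close> and, up to a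
  permutation, \<open>w4\<close>. Otherwise let \<open>H\<close> be a diagonal element of
  \<open>w\<close> with decreasing eigenvalues. Polynomials in \<open>(ad H)\<^sup>2\<close>
  separate the entries of an element \<open>A\<close> of \<open>w\<close>, its diagonal is a
  multiple of \<open>H\<close>, and so is the diagonal of \<open>[A, [H, A]]\<close>. This forces
  \<open>A\<close> to be a multiple of \<open>H\<close> unless \<open>H\<close> is proportional to
  \<open>diag(i, 0, -i)\<close>, and then yields \<open>w31\<close> or, after a diagonal
  conjugation, \<open>w32\<close>.

  The lines \<open>w1 l\<close> are told apart by \<open>tr A\<^sup>2\<close> and \<open>det
  A\<close>, which determine the spectrum, and \<open>w31\<close>, unlike \<open>w32\<close>,
  annihilates a nonzero vector.
\<close>

section \<open>Coordinates and conjugation\<close>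

text \<open>Coordinates on all skew-Hermitian matrices. Tracelessness stays a separate condition a +
  b + c = 0, so that sums, multiples and brackets become simp rules without side conditions.\<close>

definition ms :: "real \<Rightarrow> real \<Rightarrow> real \<Rightarrow> complex \<Rightarrow> complex \<Rightarrow> complex \<Rightarrow> cmat3" where
  "ms a b c x y z = vector [vector [\<i> * of_real a, x, y],
                            vector [- cnj x, \<i> * of_real b, z],
                            vector [- cnj y, - cnj z, \<i> * of_real c]]"

lemma mat3_eq_iff: "(A :: cmat3) = B \<longleftrightarrow>
    A$1$1 = B$1$1 \<and> A$1$2 = B$1$2 \<and> A$1$3 = B$1$3 \<and>
    A$2$1 = B$2$1 \<and> A$2$2 = B$2$2 \<and> A$2$3 = B$2$3 \<and>
    A$3$1 = B$3$1 \<and> A$3$2 = B$3$2 \<and> A$3$3 = B$3$3"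
  by (simp add: vec_eq_iff forall_3)

lemma ms_nth [simp]:
  "ms a b c x y z $ 1 $ 1 = \<i> * of_real a" "ms a b c x y z $ 1 $ 2 = x" "ms a b c x y z $ 1 $ 3 = y"
  "ms a b c x y z $ 2 $ 1 = - cnj x" "ms a b c x y z $ 2 $ 2 = \<i> * of_real b" "ms a b c x y z $ 2 $ 3 = z"
  "ms a b c x y z $ 3 $ 1 = - cnj y" "ms a b c x y z $ 3 $ 2 = - cnj z" "ms a b c x y z $ 3 $ 3 = \<i> * of_real c"
  by (simp_all add: ms_def)

lemma mult3_nth: "((A :: cmat3) ** B) $ i $ j = A$i$1 * B$1$j + A$i$2 * B$2$j + A$i$3 * B$3$j"
  by (simp add: matrix_matrix_mult_def sum_3)

lemma adj_nth [simp]: "adj A $ i $ j = cnj (A $ j $ i)"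
  by (simp add: adj_def)

lemma ms_eq_iff [simp]: "ms a b c x y z = ms a' b' c' x' y' z' \<longleftrightarrow>
    a = a' \<and> b = b' \<and> c = c' \<and> x = x' \<and> y = y' \<and> z = z'"
  by (auto simp: mat3_eq_iff)

text \<open>Oriented so that unfolding turns an equation with zero into one between
  \<open>ms\<close> terms, which \<open>ms_eq_iff\<close> splits into coordinates.\<close>

lemma ms_0: "0 = ms 0 0 0 0 0 0"
  by (simp add: mat3_eq_iff)

lemma ms_add [simp]: "ms a b c x y z + ms a' b' c' x' y' z' =
    ms (a + a') (b + b') (c + c') (x + x') (y + y') (z + z')"
  by (simp add: mat3_eq_iff algebra_simps)

lemma ms_scaleR [simp]: "k *\<^sub>R ms a b c x y z =
    ms (k * a) (k * b) (k * c) (of_real k * x) (of_real k * y) (of_real k * z)"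
  by (simp add: mat3_eq_iff) (simp add: scaleR_conv_of_real)

lemma ms_bracket [simp]: "lie_bracket (ms a b c x y z) (ms a' b' c' x' y' z') =
   ms (2 * Im (x' * cnj x + y' * cnj y)) (2 * Im (z' * cnj z - x' * cnj x))
      (- 2 * Im (y' * cnj y + z' * cnj z))
      (\<i> * (a - b) * x' - \<i> * (a' - b') * x - y * cnj z' + y' * cnj z)
      (\<i> * (a - c) * y' - \<i> * (a' - c') * y + x * z' - x' * z)
      (\<i> * (b - c) * z' - \<i> * (b' - c') * z - cnj x * y' + cnj x' * y)"
  by (auto simp: lie_bracket_def mat3_eq_iff mult3_nth complex_eq_iff algebra_simps)

lemma su3_eq: "su3 = {ms a b c x y z | a b c x y z. a + b + c = 0}"
proof (intro equalityI subsetI)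
  fix A :: cmat3 assume "A \<in> su3"
  then have s: "adj A = - A" and t: "trace A = 0" by (auto simp: su3_def)
  have *: "cnj (A $ j $ i) = - (A $ i $ j)" for i j
    using arg_cong[OF s, of "\<lambda>B. B $ i $ j"] by simp
  have re: "Re (A $ i $ i) = 0" for i
    using *[of i i] by (simp add: complex_eq_iff)
  have "A = ms (Im (A$1$1)) (Im (A$2$2)) (Im (A$3$3)) (A$1$2) (A$1$3) (A$2$3)"
    using re by (simp add: mat3_eq_iff complex_eq_iff *)
  moreover have "Im (A$1$1) + Im (A$2$2) + Im (A$3$3) = 0"
    using arg_cong[OF t, of Im] by (simp add: trace_def sum_3)
  ultimately show "A \<in> {ms a b c x y z | a b c x y z. a + b + c = 0}" by blast
next
  fix A assume "A \<in> {ms a b c x y z | a b c x y z. a + b + c = 0}"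
  then show "A \<in> su3"
    by (auto simp: su3_def mat3_eq_iff trace_def sum_3 simp flip: of_real_add distrib_left)
qed

lemma ms_in_su3 [simp]: "ms a b c x y z \<in> su3 \<longleftrightarrow> a + b + c = 0"
  by (auto simp: su3_eq)

lemma B_eq_ms:
  "B1 = ms 0 0 0 \<i> 0 0" "B2 = ms 0 0 0 1 0 0" "B3 = ms 0 0 0 0 \<i> 0" "B4 = ms 0 0 0 0 1 0"
  "B5 = ms 0 0 0 0 0 \<i>" "B6 = ms 0 0 0 0 0 1" "B7 = ms 1 (- 1) 0 0 0 0" "B8 = ms 0 1 (- 1) 0 0 0"
  by (simp_all add: B1_def B2_def B3_def B4_def B5_def B6_def B7_def B8_def itimes_def E_def mat3_eq_iff)

section \<open>Conjugation by special unitary matrices\<close>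

definition cj :: "cmat3 \<Rightarrow> cmat3 \<Rightarrow> cmat3" where
  "cj g A = g ** A ** adj g"

lemma matrix_inv_SU3: "g \<in> SU3 \<Longrightarrow> matrix_inv g = adj g"
  unfolding matrix_inv_def SU3_def
  by (rule some_equality) (auto, metis matrix_mul_assoc matrix_mul_lid matrix_mul_rid)

text \<open>Replaces \<open>matrix_inv\<close> by the adjoint, so that conjugation is an explicit
  polynomial in the entries of g and their conjugates.\<close>

lemma act_eq: "g \<in> SU3 \<Longrightarrow> act g w = cj g ` w"
  by (simp add: act_def cj_def[abs_def] matrix_inv_SU3)

lemma adj_adj [simp]: "adj (adj A) = A"
  by (simp add: mat3_eq_iff)

lemma adj_mult: "adj (A ** B) = adj B ** adj A"
  by (simp add: mat3_eq_iff mult3_nth algebra_simps)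

lemma adj_mat_1 [simp]: "adj (mat 1) = mat 1"
  by (simp add: mat3_eq_iff mat_def)

lemma SU3_mult: "g \<in> SU3 \<Longrightarrow> h \<in> SU3 \<Longrightarrow> g ** h \<in> SU3"
proof -
  assume g: "g \<in> SU3" and h: "h \<in> SU3"
  have "(g ** h) ** (adj h ** adj g) = g ** (h ** adj h) ** adj g" by (simp add: matrix_mul_assoc)
  moreover have "(adj h ** adj g) ** (g ** h) = adj h ** (adj g ** g) ** h" by (simp add: matrix_mul_assoc)
  ultimately show ?thesis using g h by (auto simp: SU3_def adj_mult det_mul)
qed

lemma cj_mult: "cj (g ** h) A = cj g (cj h A)"
  by (simp add: cj_def adj_mult matrix_mul_assoc)

lemma conjugate_trans: "u \<sim> v \<Longrightarrow> v \<sim> w \<Longrightarrow> u \<sim> w"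
  unfolding conjugate_def
proof clarify
  fix g h assume g: "g \<in> SU3" and h: "h \<in> SU3"
  show "\<exists>k\<in>SU3. act h (act g u) = act k u"
    by (rule bexI[of _ "h ** g"]) (auto simp: act_eq g h SU3_mult cj_mult image_image)
qed

lemma conjugate_cj: "g \<in> SU3 \<Longrightarrow> w \<sim> cj g ` w"
  by (auto simp: conjugate_def act_eq)

lemma linear_cj: "linear (cj g)"
  by (rule linearI) (auto simp: cj_def mat3_eq_iff mult3_nth algebra_simps)

lemma cj_adj_cj: assumes "g \<in> SU3" shows "cj (adj g) (cj g A) = A" "cj g (cj (adj g) A) = A"
proof -
  have "cj (adj g) (cj g A) = (adj g ** g) ** A ** (adj g ** g)"
    "cj g (cj (adj g) A) = (g ** adj g) ** A ** (g ** adj g)"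
    by (simp_all add: cj_def matrix_mul_assoc)
  then show "cj (adj g) (cj g A) = A" "cj g (cj (adj g) A) = A"
    using assms by (auto simp: SU3_def)
qed

lemma inj_cj: "g \<in> SU3 \<Longrightarrow> inj (cj g)"
  by (metis cj_adj_cj(1) injI)

lemma det_adj: "det (adj A) = cnj (det A)"
  by (simp add: det_3 algebra_simps)

lemma SU3_adj: "g \<in> SU3 \<Longrightarrow> adj g \<in> SU3"
  by (auto simp: SU3_def det_adj)

lemma cj_mat_mult: assumes "g \<in> SU3" shows "cj g (A ** B) = cj g A ** cj g B"
proof -
  have "cj g A ** cj g B = g ** A ** (adj g ** g) ** B ** adj g"
    by (simp add: cj_def matrix_mul_assoc)
  also have "adj g ** g = mat 1" using assms by (simp add: SU3_def)
  finally show ?thesis by (simp add: cj_def matrix_mul_assoc)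
qed

lemma cj_bracket: "g \<in> SU3 \<Longrightarrow> cj g (lie_bracket A B) = lie_bracket (cj g A) (cj g B)"
  by (simp add: lie_bracket_def linear_diff[OF linear_cj] cj_mat_mult)

lemma cj_su3: assumes "g \<in> SU3" "A \<in> su3" shows "cj g A \<in> su3"
proof -
  have "trace (cj g A) = trace ((adj g ** g) ** A)"
    unfolding cj_def by (metis matrix_mul_assoc trace_mul_sym)
  moreover have "adj (cj g A) = cj g (adj A)"
    by (simp add: cj_def adj_mult matrix_mul_assoc)
  moreover have "cj g (- A) = - cj g A"
    using linear_cj linear_neg by blast
  ultimately show ?thesis using assms by (auto simp: su3_def SU3_def)
qed

text \<open>Allows passing to a conjugate subalgebra. Properness survives: if the image were all of
  \<open>su3\<close>, injectivity would put every element of \<open>su3\<close> into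
  \<open>w\<close>.\<close>

lemma nonzero_proper_subalgebra_cj:
  assumes g: "g \<in> SU3" and w: "nonzero_proper_subalgebra w"
  shows "nonzero_proper_subalgebra (cj g ` w)"
proof -
  have subspace_w: "subspace w" "w \<subseteq> su3" and br: "\<And>A B. A \<in> w \<Longrightarrow> B \<in> w \<Longrightarrow> lie_bracket A B \<in> w"
    and nz: "w \<noteq> {0}" "w \<noteq> su3"
    using w by (auto simp: nonzero_proper_subalgebra_def lie_subalgebra_def)
  have "subspace (cj g ` w)" using subspace_w linear_cj linear_subspace_image by blast
  moreover have "cj g ` w \<subseteq> su3" using subspace_w cj_su3 g by blast
  moreover have "lie_bracket A B \<in> cj g ` w" if "A \<in> cj g ` w" "B \<in> cj g ` w" for A B
    using that br by (auto simp flip: cj_bracket[OF g])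
  moreover have "cj g ` w \<noteq> {0}"
  proof
    assume "cj g ` w = {0}"
    then have "cj (adj g) ` cj g ` w = {0}" by (simp add: linear_0[OF linear_cj])
    then show False using nz by (simp add: image_image cj_adj_cj g)
  qed
  moreover have "cj g ` w \<noteq> su3"
  proof
    assume s: "cj g ` w = su3"
    have "su3 \<subseteq> w"
    proof
      fix A assume "A \<in> su3"
      then have "cj g A \<in> cj g ` w" using s cj_su3 g by blast
      then show "A \<in> w" using inj_cj[OF g] by (simp add: inj_image_mem_iff)
    qed
    then show False using nz subspace_w by blast
  qed
  ultimately show ?thesis by (simp add: nonzero_proper_subalgebra_def lie_subalgebra_def)
qed

section \<open>The listed subalgebras\<close>

text \<open>Presents a span as the range of a linear map. For the listed algebras this map is
  injective, so one presentation yields both membership in coordinates and the dimension.\<close>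

lemma span_eqI:
  assumes "linear f" "S \<subseteq> range f" "range f \<subseteq> span S"
  shows "span S = range f"
  using assms by (intro equalityI span_minimal linear_subspace_image) auto

definition param1 :: "real \<Rightarrow> real \<Rightarrow> cmat3" where
  "param1 l = (\<lambda>k. ms k (k * (l - 1)) (- k * l) 0 0 0)"

definition param2 :: "real \<times> real \<Rightarrow> cmat3" where
  "param2 = (\<lambda>(a, c). ms a (- a - c) c 0 0 0)"

text \<open>This is su(2) acting on the first and third coordinates.\<close>

definition param31 :: "real \<times> complex \<Rightarrow> cmat3" where
  "param31 = (\<lambda>(a, y). ms a 0 (- a) 0 y 0)"

text \<open>This is su(2) in its irreducible three-dimensional representation, a conjugate of
  so(3).\<close>

definition param32 :: "real \<times> complex \<Rightarrow> cmat3" where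
  "param32 = (\<lambda>(a, x). ms a 0 (- a) x 0 x)"

definition param4 :: "real \<times> real \<times> complex \<Rightarrow> cmat3" where
  "param4 = (\<lambda>(a, c, y). ms a (- a - c) c 0 y 0)"

lemma linear_param: "linear (param1 l)" "linear param2" "linear param31" "linear param32" "linear param4"
  by (auto intro!: linearI simp: param1_def param2_def param31_def param32_def param4_def algebra_simps scaleR_complex.ctr complex_eq_iff)

lemma inj_param: "inj (param1 l)" "inj param2" "inj param31" "inj param32" "inj param4"
  by (auto intro!: injI simp: param1_def param2_def param31_def param32_def param4_def)

lemma span_linear_combinationI:
  "A \<in> S \<Longrightarrow> X = a *\<^sub>R A \<Longrightarrow> X \<in> span S"
  "A \<in> S \<Longrightarrow> B \<in> S \<Longrightarrow> X = a *\<^sub>R A + b *\<^sub>R B \<Longrightarrow> X \<in> span S"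
  "A \<in> S \<Longrightarrow> B \<in> S \<Longrightarrow> C \<in> S \<Longrightarrow> X = a *\<^sub>R A + b *\<^sub>R B + c *\<^sub>R C \<Longrightarrow> X \<in> span S"
  "A \<in> S \<Longrightarrow> B \<in> S \<Longrightarrow> C \<in> S \<Longrightarrow> D \<in> S \<Longrightarrow>
    X = a *\<^sub>R A + b *\<^sub>R B + c *\<^sub>R C + d *\<^sub>R D \<Longrightarrow> X \<in> span S"
  by (simp_all add: span_add span_scale span_base del: scaleR_scaleR)

lemma w_eq_range_param:
  "w1 l = range (param1 l)" "w2 = range param2" "w31 = range param31" "w32 = range param32" "w4 = range param4"
proof -
  show "w1 l = range (param1 l)"
    unfolding w1_def
    by (rule span_eqI[OF linear_param(1)]) (auto simp: image_iff B_eq_ms param1_def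
        intro!: exI[of _ 1] span_linear_combinationI(1)[of "ms 1 (l - 1) (- l) 0 0 0" _ _ k for k])
  show "w2 = range param2"
    unfolding w2_def
  proof (rule span_eqI)
    show "range param2 \<subseteq> span {B7, B8}"
      by (auto simp: param2_def B_eq_ms intro: span_linear_combinationI(2)[of B7 _ B8 _ a "-c" for a c])
  qed (rule linear_param(2), auto simp: image_iff B_eq_ms param2_def)
  show "w31 = range param31"
    unfolding w31_def
  proof (rule span_eqI)
    show "range param31 \<subseteq> span {B3, B4, B7 + B8}"
      by (auto simp: param31_def B_eq_ms complex_eq_iff
          intro!: span_linear_combinationI(3)[of B3 _ B4 "B7 + B8" _ "Im y" "Re y" a for a y])
  qed (rule linear_param(3), auto simp: image_iff B_eq_ms param31_def)
  show "w32 = range param32"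
    unfolding w32_def
  proof (rule span_eqI)
    show "range param32 \<subseteq> span {B1 + B5, B2 + B6, B7 + B8}"
      by (auto simp: param32_def B_eq_ms complex_eq_iff
          intro!: span_linear_combinationI(3)[of "B1 + B5" _ "B2 + B6" "B7 + B8" _ "Im y" "Re y" a for a y])
  qed (rule linear_param(4), auto simp: image_iff B_eq_ms param32_def)
  show "w4 = range param4"
    unfolding w4_def
  proof (rule span_eqI)
    show "range param4 \<subseteq> span {B3, B4, B7, B8}"
      by (auto simp: param4_def B_eq_ms complex_eq_iff
          intro!: span_linear_combinationI(4)[of B3 _ B4 B7 B8 _ "Im y" "Re y" a "-c" for a c y])
  qed (rule linear_param(5), auto simp: image_iff B_eq_ms param4_def)
qed

lemma ms_mem_w:
  "ms a b c x y z \<in> w1 l \<longleftrightarrow> b = a * (l - 1) \<and> c = - a * l \<and> x = 0 \<and> y = 0 \<and> z = 0"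
  "ms a b c x y z \<in> w2 \<longleftrightarrow> a + b + c = 0 \<and> x = 0 \<and> y = 0 \<and> z = 0"
  "ms a b c x y z \<in> w31 \<longleftrightarrow> b = 0 \<and> c = - a \<and> x = 0 \<and> z = 0"
  "ms a b c x y z \<in> w32 \<longleftrightarrow> b = 0 \<and> c = - a \<and> y = 0 \<and> z = x"
  "ms a b c x y z \<in> w4 \<longleftrightarrow> a + b + c = 0 \<and> x = 0 \<and> z = 0"
  by (auto simp: w_eq_range_param param1_def param2_def param31_def param32_def param4_def image_iff)

lemma dim_range_inj:
  fixes f :: "'a::euclidean_space \<Rightarrow> cmat3"
  shows "linear f \<Longrightarrow> inj f \<Longrightarrow> dim (range f) = DIM('a)"
  by (simp add: dim_image_eq)

lemma dim_w: "dim (w1 l) = 1" "dim w2 = 2" "dim w31 = 3" "dim w32 = 3" "dim w4 = 4"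
  by (simp_all add: w_eq_range_param dim_range_inj linear_param inj_param)

lemma w_subset_su3: "w1 l \<subseteq> su3" "w2 \<subseteq> su3" "w31 \<subseteq> su3" "w32 \<subseteq> su3" "w4 \<subseteq> su3"
  by (auto simp: w_eq_range_param param1_def param2_def param31_def param32_def param4_def algebra_simps)

text \<open>\<open>B1\<close> serves as a common witness of properness, since it lies in none of the
  listed algebras.\<close>

lemma nonzero_proper_subalgebraI:
  assumes "subspace w" "w \<subseteq> su3" "dim w > 0" "B1 \<notin> w"
    and "\<And>a b c x y z a' b' c' x' y' z'. ms a b c x y z \<in> w \<Longrightarrow> ms a' b' c' x' y' z' \<in> w \<Longrightarrow>
      lie_bracket (ms a b c x y z) (ms a' b' c' x' y' z') \<in> w"
  shows "nonzero_proper_subalgebra w"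
proof -
  have "lie_bracket A B \<in> w" if "A \<in> w" "B \<in> w" for A B
  proof -
    from that have "A \<in> su3" "B \<in> su3" using assms(2) by auto
    then show ?thesis using that assms(5) unfolding su3_eq by blast
  qed
  moreover have "w \<noteq> {0}" using assms(3) by auto
  moreover have "w \<noteq> su3" using assms(4) by (auto simp: B_eq_ms)
  ultimately show ?thesis using assms(1,2) by (auto simp: nonzero_proper_subalgebra_def lie_subalgebra_def)
qed

lemma nonzero_proper_subalgebra_w: "nonzero_proper_subalgebra (w1 l)" "nonzero_proper_subalgebra w2"
  "nonzero_proper_subalgebra w31" "nonzero_proper_subalgebra w32" "nonzero_proper_subalgebra w4"
proof -
  show "nonzero_proper_subalgebra (w1 l)"
    by (rule nonzero_proper_subalgebraI)
      (auto simp: dim_w w_subset_su3 ms_mem_w B_eq_ms subspace_span[of "{B7 + l *\<^sub>R B8}", folded w1_def])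
  show "nonzero_proper_subalgebra w2"
    by (rule nonzero_proper_subalgebraI)
      (auto simp: dim_w w_subset_su3 ms_mem_w B_eq_ms subspace_span[of "{B7, B8}", folded w2_def])
  show "nonzero_proper_subalgebra w31"
    by (rule nonzero_proper_subalgebraI)
      (auto simp: dim_w w_subset_su3 ms_mem_w B_eq_ms subspace_span[of "{B3, B4, B7 + B8}", folded w31_def])
  show "nonzero_proper_subalgebra w32"
    by (rule nonzero_proper_subalgebraI)
      (auto simp: dim_w w_subset_su3 ms_mem_w B_eq_ms algebra_simps subspace_span[of "{B1 + B5, B2 + B6, B7 + B8}", folded w32_def])
  show "nonzero_proper_subalgebra w4"
    by (rule nonzero_proper_subalgebraI)
      (auto simp: dim_w w_subset_su3 ms_mem_w B_eq_ms algebra_simps subspace_span[of "{B3, B4, B7, B8}", folded w4_def])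
qed

section \<open>Telling the listed subalgebras apart\<close>

lemma conjugate_dim: "u \<sim> v \<Longrightarrow> dim u = dim v"
  by (auto simp: conjugate_def act_eq dim_image_eq linear_cj inj_on_subset[OF inj_cj])

lemma not_conjugate_if_dim_neq: "dim u \<noteq> dim v \<Longrightarrow> \<not> u \<sim> v"
  using conjugate_dim by blast

lemma not_conjugate_w31_w32: "\<not> w31 \<sim> w32"
proof
  assume "w31 \<sim> w32"
  then obtain g where g: "g \<in> SU3" and w: "w32 = cj g ` w31"
    by (auto simp: conjugate_def act_eq)
  define v where "v = g *v axis 2 1"
  \<comment> \<open>The second basis vector is killed by \<open>w31\<close>, so its image under g is
    killed by the conjugate algebra.\<close>
  have kill: "A *v v = 0" if A: "A \<in> w32" for A
  proof -
    obtain a y where B: "A = cj g (ms a 0 (- a) 0 y 0)"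
      using A by (auto simp: w w_eq_range_param param31_def)
    have "A *v v = (g ** ms a 0 (- a) 0 y 0 ** (adj g ** g)) *v axis 2 1"
      by (simp add: B cj_def v_def matrix_vector_mul_assoc matrix_mul_assoc)
    also have "\<dots> = g *v (ms a 0 (- a) 0 y 0 *v axis 2 1)"
      using g by (simp add: SU3_def matrix_vector_mul_assoc)
    also have "ms a 0 (- a) 0 y 0 *v axis 2 1 = 0"
      by (simp add: vec_eq_iff forall_3 matrix_vector_mult_def sum_3 axis_def)
    finally show ?thesis by simp
  qed
  \<comment> \<open>The first element forces the outer coordinates of \<open>v\<close> to vanish,
    the second one the middle coordinate.\<close>
  have "ms 1 0 (- 1) 0 0 0 *v v = 0" "ms 0 0 0 1 0 1 *v v = 0"
    by (auto intro!: kill simp: ms_mem_w)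
  then have "v = 0"
    by (simp add: vec_eq_iff forall_3 matrix_vector_mult_def sum_3)
  then have "adj g *v (g *v axis 2 1) = 0" by (simp add: v_def)
  then have "axis 2 1 = (0 :: complex^3)"
    using g by (simp add: SU3_def matrix_vector_mul_assoc)
  then show False by (simp add: axis_eq_0_iff)
qed

section \<open>Conjugacies within the one-parameter family\<close>

definition swap12 :: cmat3 where "swap12 = vector [vector [0, 1, 0], vector [- 1, 0, 0], vector [0, 0, 1]]"
definition swap23 :: cmat3 where "swap23 = vector [vector [1, 0, 0], vector [0, 0, 1], vector [0, - 1, 0]]"

lemma swap_SU3: "swap12 \<in> SU3" "swap23 \<in> SU3"
  by (simp_all add: SU3_def swap12_def swap23_def mat3_eq_iff mult3_nth mat_def det_3)

text \<open>The sign in each swap makes its determinant one. On diagonal matrices these are the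
  adjacent transpositions, which generate all permutations.\<close>

lemma cj_swap: "cj swap12 (ms a b c x y z) = ms b a c (cnj x) z (- y)"
  "cj swap23 (ms a b c x y z) = ms a c b y (- x) (cnj z)"
  by (simp_all add: cj_def swap12_def swap23_def mat3_eq_iff mult3_nth)

lemma w1_eq_span: "w1 l = span {ms 1 (l - 1) (- l) 0 0 0}"
  by (simp add: w1_def B_eq_ms)

lemma conjugate_span_singleton: "g \<in> SU3 \<Longrightarrow> span {A} \<sim> span {cj g A}"
  using conjugate_cj[of g "span {A}"] by (simp add: linear_span_image[OF linear_cj, symmetric])

lemma conjugate_swap12: "span {ms a b c 0 0 0} \<sim> span {ms b a c 0 0 0}"
  using conjugate_span_singleton[OF swap_SU3(1), of "ms a b c 0 0 0"] by (simp add: cj_swap)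

lemma conjugate_swap23: "span {ms a b c 0 0 0} \<sim> span {ms a c b 0 0 0}"
  using conjugate_span_singleton[OF swap_SU3(2), of "ms a b c 0 0 0"] by (simp add: cj_swap)

lemma span_diag_eq_w1: 
  assumes "k \<noteq> 0" "a = k" "b = k * (m - 1)" "c = - k * m"
  shows "span {ms a b c 0 0 0} = w1 m"
proof -
  have "ms a b c 0 0 0 = k *\<^sub>R ms 1 (m - 1) (- m) 0 0 0" by (simp add: assms)
  then show ?thesis using assms(1) by (simp add: w1_eq_span span_image_scale[of "{_}" "\<lambda>_. k", simplified] del: ms_scaleR)
qed

text \<open>The generator of \<open>w1 l\<close> is conjugate to k times that of
  \<open>w1 m\<close>. Since both are traceless, tr A^2 and det A encode the remaining two
  elementary symmetric functions of the spectrum.\<close>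

lemma conjugate_w1_invariants:
  assumes "w1 l \<sim> w1 m"
  obtains k where "k^2 * (m\<^sup>2 - m + 1) = l\<^sup>2 - l + 1" "k^3 * (m\<^sup>2 - m) = l\<^sup>2 - l"
proof -
  obtain g where g: "g \<in> SU3" and w: "w1 m = cj g ` w1 l"
    using assms by (auto simp: conjugate_def act_eq)
  let ?L = "ms 1 (l - 1) (- l) 0 0 0"
  have "cj g ?L \<in> w1 m"
    unfolding w by (auto simp: w1_eq_span span_base)
  then obtain k where k: "cj g ?L = k *\<^sub>R ms 1 (m - 1) (- m) 0 0 0"
    by (auto simp: w1_eq_span span_singleton)
  have tr: "trace (cj g A) = trace A" for A
  proof -
    have "trace (cj g A) = trace ((adj g ** g) ** A)"
      unfolding cj_def by (metis matrix_mul_assoc trace_mul_sym)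
    then show ?thesis using g by (simp add: SU3_def)
  qed
  have dt: "det (cj g A) = det A" for A
    using g by (simp add: cj_def det_mul SU3_def det_adj)
  have "trace (?L ** ?L) = trace (cj g ?L ** cj g ?L)"
    by (metis tr cj_mat_mult[OF g])
  from arg_cong[OF this, of Re] have "k^2 * (m\<^sup>2 - m + 1) = l\<^sup>2 - l + 1"
    by (simp add: k trace_def sum_3 mult3_nth power2_eq_square algebra_simps)
  moreover have "det ?L = det (cj g ?L)" by (simp only: dt)
  from arg_cong[OF this, of Im] have "k^3 * (m\<^sup>2 - m) = l\<^sup>2 - l"
    by (simp add: k det_3 power2_eq_square power3_eq_cube algebra_simps)
  ultimately show thesis using that by blast
qed

text \<open>The hypotheses say that k, k(m - 1), -km and 1, l - 1, -l are the roots of the same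
  cubic. Matching the root 1 with one of the first three fixes k, and the second hypothesis becomes
  an equation that factors into the two formulas of that case.\<close>

lemma w1_parameter_cases:
  fixes k l m :: real
  assumes a: "k^2 * (m\<^sup>2 - m + 1) = l\<^sup>2 - l + 1" and b: "k^3 * (m\<^sup>2 - m) = l\<^sup>2 - l"
  shows "m = l \<or> m = 1 - l \<or> (l \<noteq> 0 \<and> m = 1 / l) \<or> (l \<noteq> 0 \<and> m = (l - 1) / l) \<or>
      (l - 1 \<noteq> 0 \<and> m = l / (l - 1)) \<or> (1 - l \<noteq> 0 \<and> m = 1 / (1 - l))"
proof -
  have roots: "(t - k) * (t - k * (m - 1)) * (t + k * m) = (t - 1) * (t - (l - 1)) * (t + l)" for t
  proof -
    have "(t - k) * (t - k * (m - 1)) * (t + k * m) = t^3 - k^2 * (m\<^sup>2 - m + 1) * t + k^3 * (m\<^sup>2 - m)"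
      by (simp add: algebra_simps power2_eq_square power3_eq_cube)
    also have "\<dots> = (t - 1) * (t - (l - 1)) * (t + l)"
      unfolding a b by (simp add: algebra_simps power2_eq_square power3_eq_cube)
    finally show ?thesis .
  qed
  have 1: "k = 1 \<or> k * (m - 1) = 1 \<or> k * m = - 1" using roots[of 1] by auto
  have 2: "l - 1 = k \<or> l - 1 = k * (m - 1) \<or> l - 1 = - k * m" using roots[of "l - 1"] by auto
  have 3: "l = - k \<or> l = - k * (m - 1) \<or> l = k * m" using roots[of "- l"] by auto
  have "m \<noteq> 1 \<and> k = 1 / (m - 1)" if "k * (m - 1) = 1"
    using that by (cases "m = 1") (auto simp: eq_divide_eq)
  moreover have "m \<noteq> 0 \<and> k = - 1 / m" if "k * m = - 1"
    using that by (cases "m = 0") (auto simp: eq_divide_eq eq_minus_divide_eq)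
  ultimately consider "k = 1" | "k * (m - 1) = 1" "m \<noteq> 1" "k = 1 / (m - 1)"
    | "k * m = - 1" "m \<noteq> 0" "k = - 1 / m"
    using 1 by blast
  then show ?thesis
  proof cases
    case 1
    then have "(m - l) * (m + l - 1) = 0" using b by (simp add: algebra_simps power2_eq_square)
    then show ?thesis unfolding mult_eq_0_iff by argo
  next
    case 2
    have "l * (l - 1) * (m - 1)^2 = m"
      using b 2(1) by algebra
    moreover have "(l * (m - 1) - m) * (l * (m - 1) + 1) = l * (l - 1) * (m - 1)^2 - m"
      by (simp add: algebra_simps power2_eq_square)
    ultimately have "(l * (m - 1) - m) * (l * (m - 1) + 1) = 0" by (simp only: diff_self)
    then have "m * (l - 1) = l \<or> l * m = l - 1"
      unfolding mult_eq_0_iff by (auto simp: algebra_simps)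
    then show ?thesis by (cases "l = 0"; cases "l = 1") (auto simp: field_simps)
  next
    case 3
    have "l * (l - 1) * m^2 = 1 - m"
      using b 3(1) by algebra
    moreover have "(l * m - 1) * (l * m + 1 - m) = l * (l - 1) * m^2 - (1 - m)"
      by (simp add: algebra_simps power2_eq_square)
    ultimately have "(l * m - 1) * (l * m + 1 - m) = 0" by (simp only: diff_self)
    then have "m * l = 1 \<or> m * (1 - l) = 1"
      unfolding mult_eq_0_iff by (auto simp: algebra_simps)
    then show ?thesis by (cases "l = 0"; cases "l = 1") (auto simp: field_simps)
  qed
qed

lemma w1_conjugateI:
  assumes "m = l \<or> m = 1 - l \<or> (l \<noteq> 0 \<and> m = 1 / l) \<or> (l \<noteq> 0 \<and> m = (l - 1) / l) \<or>
      (l - 1 \<noteq> 0 \<and> m = l / (l - 1)) \<or> (1 - l \<noteq> 0 \<and> m = 1 / (1 - l))"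
  shows "w1 l \<sim> w1 m"
proof -
  \<comment> \<open>The six formulas are the six orderings of the eigenvalues, rescaled to have
    first entry 1. A denominator vanishes exactly when the first entry of its ordering is
    zero.\<close>
  have P: "w1 l \<sim> span {ms a b c 0 0 0}"
    if "(a, b, c) \<in> {(1, l - 1, - l), (1, - l, l - 1), (l - 1, 1, - l),
      (l - 1, - l, 1), (- l, 1, l - 1), (- l, l - 1, 1)}" for a b c
    unfolding w1_eq_span using that
    by (elim insertE emptyE; simp only: prod.inject)
      (meson conjugate_swap12 conjugate_swap23 conjugate_trans)+
  consider "m = l" | "m = 1 - l" | "l \<noteq> 0" "m = 1 / l" | "l \<noteq> 0" "m = (l - 1) / l"
    | "l - 1 \<noteq> 0" "m = l / (l - 1)" | "l - 1 \<noteq> 0" "m = 1 / (1 - l)"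
    using assms by auto
  then show ?thesis
  proof cases
    case 1
    then show ?thesis using P[of 1 "l - 1" "- l"] by (simp add: w1_eq_span)
  next
    case 2
    then show ?thesis using P[of 1 "- l" "l - 1"] by (simp add: w1_eq_span)
  next
    case 3
    then have "span {ms (- l) (l - 1) 1 0 0 0} = w1 m"
      by (intro span_diag_eq_w1[of "- l"]) (auto simp: field_simps)
    then show ?thesis using P[of "- l" "l - 1" 1] by simp
  next
    case 4
    then have "span {ms (- l) 1 (l - 1) 0 0 0} = w1 m"
      by (intro span_diag_eq_w1[of "- l"]) (auto simp: field_simps)
    then show ?thesis using P[of "- l" 1 "l - 1"] by simp
  next
    case 5
    then have "span {ms (l - 1) 1 (- l) 0 0 0} = w1 m"
      by (intro span_diag_eq_w1[of "l - 1"]) (auto simp: field_simps)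
    then show ?thesis using P[of "l - 1" 1 "- l"] by simp
  next
    case 6
    have "(1 - l) * m = 1" if "1 - l \<noteq> 0" using that by (simp only: 6(2) times_divide_eq_right mult_1_right divide_self not_False_eq_True)
    then have "span {ms (l - 1) (- l) 1 0 0 0} = w1 m"
      using 6(1) by (intro span_diag_eq_w1[of "l - 1"]) (auto simp: algebra_simps)
    then show ?thesis using P[of "l - 1" "- l" 1] by simp
  qed
qed

section \<open>Simultaneous diagonalization\<close>

definition rot12 :: "real \<Rightarrow> real \<Rightarrow> complex \<Rightarrow> cmat3" where
  "rot12 c s e = vector [vector [of_real c, of_real s * e, 0], vector [- of_real s * cnj e, of_real c, 0], vector [0, 0, 1]]"
definition rot13 :: "real \<Rightarrow> real \<Rightarrow> complex \<Rightarrow> cmat3" where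
  "rot13 c s e = vector [vector [of_real c, 0, of_real s * e], vector [0, 1, 0], vector [- of_real s * cnj e, 0, of_real c]]"
definition rot23 :: "real \<Rightarrow> real \<Rightarrow> complex \<Rightarrow> cmat3" where
  "rot23 c s e = vector [vector [1, 0, 0], vector [0, of_real c, of_real s * e], vector [0, - of_real s * cnj e, of_real c]]"

lemma rot_SU3:
  assumes "c\<^sup>2 + s\<^sup>2 = 1" "cmod e = 1"
  shows "rot12 c s e \<in> SU3" "rot13 c s e \<in> SU3" "rot23 c s e \<in> SU3"
proof -
  have e: "e * cnj e = 1" using assms(2) by (simp flip: complex_norm_square)
  have "complex_of_real (c\<^sup>2 + s\<^sup>2) = 1" using assms(1) by simp
  then have c: "complex_of_real c * of_real c + of_real s * of_real s = 1"
    by (simp add: power2_eq_square)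
  have 1: "complex_of_real c * of_real c + of_real s * e * (of_real s * cnj e) = 1"
    using c e by algebra
  show "rot12 c s e \<in> SU3" "rot13 c s e \<in> SU3" "rot23 c s e \<in> SU3"
    using 1 by (simp_all add: SU3_def rot12_def rot13_def rot23_def mat3_eq_iff mult3_nth mat_def det_3 algebra_simps)
qed

section \<open>Maximizing the height over an orbit\<close>

definition height :: "cmat3 \<Rightarrow> real" where
  "height A = Im (A $ 1 $ 1) - Im (A $ 3 $ 3)"

text \<open>A rotation moves one amount between the two diagonal entries of its plane. Only for
  \<open>rot13\<close> do both entries count in the height, whence the factor 2.\<close>

lemma height_rot:
  assumes "c\<^sup>2 + s\<^sup>2 = 1" "cmod e = 1"
  shows "height (cj (rot12 c s e) (ms a b d x y z)) = height (ms a b d x y z) + (s\<^sup>2 * (b - a) + 2 * c * s * Im (x * cnj e))"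
   "height (cj (rot13 c s e) (ms a b d x y z)) = height (ms a b d x y z) + 2 * (s\<^sup>2 * (d - a) + 2 * c * s * Im (y * cnj e))"
   "height (cj (rot23 c s e) (ms a b d x y z)) = height (ms a b d x y z) + (s\<^sup>2 * (d - b) + 2 * c * s * Im (z * cnj e))"
proof -
  have e: "Im e * Im e = 1 - Re e * Re e" using assms(2) by (simp add: cmod_def power2_eq_square algebra_simps)
  have c: "c * c = 1 - s * s" using assms(1) by (simp add: power2_eq_square)
  show
   "height (cj (rot12 c s e) (ms a b d x y z)) = height (ms a b d x y z) + (s\<^sup>2 * (b - a) + 2 * c * s * Im (x * cnj e))"
    using e c by (simp add: height_def cj_def rot12_def mult3_nth power2_eq_square) algebra
  show
   "height (cj (rot13 c s e) (ms a b d x y z)) = height (ms a b d x y z) + 2 * (s\<^sup>2 * (d - a) + 2 * c * s * Im (y * cnj e))"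
    using e c by (simp add: height_def cj_def rot13_def mult3_nth power2_eq_square) algebra
  show
   "height (cj (rot23 c s e) (ms a b d x y z)) = height (ms a b d x y z) + (s\<^sup>2 * (d - b) + 2 * c * s * Im (z * cnj e))"
    using e c by (simp add: height_def cj_def rot23_def mult3_nth power2_eq_square) algebra
qed

text \<open>A quarter turn gives the sign of d. For small angles the term linear in s dominates the
  quadratic one, so it has to vanish for every phase e.\<close>

lemma rotation_maximum_vanish:
  fixes x :: complex
  assumes "\<And>c s e. c\<^sup>2 + s\<^sup>2 = 1 \<Longrightarrow> cmod e = 1 \<Longrightarrow> s\<^sup>2 * d + 2 * c * s * Im (x * cnj e) \<le> 0"
  shows "x = 0 \<and> d \<le> 0"
proof
  show "d \<le> 0" using assms[of 0 1 1] by simp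
  show "x = 0"
  proof (rule ccontr)
    assume x: "x \<noteq> 0"
    \<comment> \<open>This phase turns the linear term into the full modulus of x.\<close>
    define e where "e = - \<i> * sgn x"
    have e: "cmod e = 1" using x by (simp add: e_def norm_mult norm_sgn)
    have "x * cnj (sgn x) = of_real (cmod x)"
      using x complex_norm_square[of x]
      by (simp add: sgn_div_norm scaleR_conv_of_real power2_eq_square field_simps)
    then have xe: "Im (x * cnj e) = cmod x" by (simp add: e_def algebra_simps)
    \<comment> \<open>The tangent of the rotation angle, small enough that t |d| is at most |x| and
      hence below 2 |x|.\<close>
    define t where "t = cmod x / (1 + \<bar>d\<bar>)"
    have t: "t > 0" "t * \<bar>d\<bar> \<le> cmod x" using x by (auto simp: t_def field_simps)
    define c where "c = 1 / sqrt (1 + t\<^sup>2)"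
    define s where "s = t * c"
    have c0: "c > 0" unfolding c_def by (simp add: add_pos_nonneg)
    have "c\<^sup>2 * (1 + t\<^sup>2) = 1"
      unfolding c_def by (simp add: power_divide add_nonneg_eq_0_iff)
    then have "c\<^sup>2 + s\<^sup>2 = 1" by (simp add: s_def power_mult_distrib algebra_simps)
    from assms[OF this e, unfolded xe] have "c\<^sup>2 * (t * (t * d + 2 * cmod x)) \<le> 0"
      by (simp add: s_def power2_eq_square algebra_simps)
    then have "t * (t * d + 2 * cmod x) \<le> 0" using c0 by (simp add: mult_le_0_iff)
    then have "t * d + 2 * cmod x \<le> 0" using t by (simp add: mult_le_0_iff)
    moreover have "t * d \<ge> - (t * \<bar>d\<bar>)" using t by (cases "d \<ge> 0") auto
    ultimately show False using t zero_less_norm_iff[of x] x by linarith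
  qed
qed

lemma continuous_on_mult3:
  fixes f g :: "'a::topological_space \<Rightarrow> cmat3"
  assumes "continuous_on S f" "continuous_on S g"
  shows "continuous_on S (\<lambda>x. f x ** g x)"
  unfolding matrix_matrix_mult_def by (intro continuous_intros assms)

lemma continuous_on_adj:
  assumes "continuous_on S f"
  shows "continuous_on S (\<lambda>x. adj (f x))"
  unfolding adj_def by (intro continuous_intros assms)

lemma compact_SU3: "compact SU3"
proof -
  have "closed SU3"
    unfolding SU3_def det_3
    by (intro closed_Collect_conj closed_Collect_eq continuous_intros continuous_on_mult3 continuous_on_adj)
  moreover have "bounded SU3"
  proof (rule boundedI)
    fix g assume g: "g \<in> SU3"
    have *: "norm (g $ i) = 1" for i
    proof -
      have "(g ** adj g) $ i $ i = 1" using g by (simp add: SU3_def mat_def)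
      then have "of_real ((cmod (g$i$1))\<^sup>2 + (cmod (g$i$2))\<^sup>2 + (cmod (g$i$3))\<^sup>2) = (1::complex)"
        by (simp add: mult3_nth complex_norm_square[symmetric])
      then have "(cmod (g$i$1))\<^sup>2 + (cmod (g$i$2))\<^sup>2 + (cmod (g$i$3))\<^sup>2 = 1"
        using of_real_eq_1_iff by blast
      then show ?thesis by (simp add: norm_vec_def L2_set_def sum_3)
    qed
    show "norm g \<le> 3"
      by (simp add: norm_vec_def[of g] L2_set_def sum_3 * real_le_lsqrt)
  qed
  ultimately show ?thesis by (simp add: compact_eq_bounded_closed)
qed

lemma cj_commuting:
  assumes "g \<in> SU3" "g ** H = H ** g" shows "cj g H = H"
proof -
  have "cj g H = H ** (g ** adj g)" by (simp add: cj_def assms matrix_mul_assoc)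
  then show ?thesis using assms by (simp add: SU3_def)
qed

text \<open>The height of conjugates of K is maximized over the compact centralizer of the diagonal
  matrix. For a = b = c = 0 the centralizer is all of \<open>SU3\<close>, and the lemma diagonalizes
  a single element with sorted eigenvalues.\<close>

lemma diagonalize_commuting:
  assumes K: "K \<in> su3" and comm: "lie_bracket (ms a b c 0 0 0) K = 0"
  obtains g a' b' c' where "g \<in> SU3" "cj g (ms a b c 0 0 0) = ms a b c 0 0 0"
    "cj g K = ms a' b' c' 0 0 0" "a' + b' + c' = 0"
    "a = b \<longrightarrow> b' \<le> a'" "b = c \<longrightarrow> c' \<le> b'"
proof -
  let ?H = "ms a b c 0 0 0"
  define G where "G = SU3 \<inter> {g. g ** ?H = ?H ** g}"
  have "closed {g. g ** ?H = ?H ** g}"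
    by (intro closed_Collect_eq continuous_intros continuous_on_mult3)
  then have "compact G" unfolding G_def by (rule compact_Int_closed[OF compact_SU3])
  moreover have "mat 1 \<in> G" by (simp add: G_def SU3_def)
  moreover have "continuous_on G (\<lambda>g. height (cj g K))"
    unfolding height_def cj_def by (intro continuous_intros continuous_on_mult3 continuous_on_adj)
  ultimately obtain g where g: "g \<in> G" and max: "\<And>h. h \<in> G \<Longrightarrow> height (cj h K) \<le> height (cj g K)"
    using continuous_attains_sup[of G] by blast
  have gS: "g \<in> SU3" and gH: "g ** ?H = ?H ** g" using g by (auto simp: G_def)
  have cH: "cj g ?H = ?H" using cj_commuting[OF gS gH] .
  have "cj g K \<in> su3" using cj_su3 gS K by blast
  then obtain a' b' c' x y z where K': "cj g K = ms a' b' c' x y z" and tr: "a' + b' + c' = 0"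
    by (auto simp: su3_eq)
  have max': "height (cj u (ms a' b' c' x y z)) \<le> height (ms a' b' c' x y z)"
    if "u \<in> SU3" "u ** ?H = ?H ** u" for u
  proof -
    have "u ** g ** ?H = ?H ** (u ** g)"
      by (metis gH that(2) matrix_mul_assoc)
    then have "u ** g \<in> G" using gS that by (simp add: G_def SU3_mult)
    from max[OF this] show ?thesis by (simp add: cj_mult K')
  qed
  \<comment> \<open>Commuting kills the entries between distinct eigenvalues of H. Any other entry
    lies in a plane where H is scalar, so rotations of that plane stay in the centralizer and
    maximality applies.\<close>
  have "lie_bracket ?H (cj g K) = cj g (lie_bracket ?H K)"
    by (simp only: cj_bracket[OF gS] cH)
  also have "\<dots> = 0" by (simp only: comm linear_0[OF linear_cj])
  finally have off: "(a - b) * x = 0" "(a - c) * y = 0" "(b - c) * z = 0"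
    by (auto simp: K' ms_0)
  have "x = 0 \<and> b' - a' \<le> 0" if "a = b"
  proof (rule rotation_maximum_vanish)
    fix c s :: real and e assume *: "c\<^sup>2 + s\<^sup>2 = 1" "cmod e = 1"
    show "s\<^sup>2 * (b' - a') + 2 * c * s * Im (x * cnj e) \<le> 0"
      using max'[OF rot_SU3(1)[OF *]] that
      by (simp add: height_rot[OF *]) (simp add: mat3_eq_iff mult3_nth rot12_def)
  qed
  moreover have "y = 0 \<and> c' - a' \<le> 0" if "a = c"
  proof (rule rotation_maximum_vanish)
    fix c s :: real and e assume *: "c\<^sup>2 + s\<^sup>2 = 1" "cmod e = 1"
    show "s\<^sup>2 * (c' - a') + 2 * c * s * Im (y * cnj e) \<le> 0"
      using max'[OF rot_SU3(2)[OF *]] that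
      by (simp add: height_rot[OF *]) (simp add: mat3_eq_iff mult3_nth rot13_def)
  qed
  moreover have "z = 0 \<and> c' - b' \<le> 0" if "b = c"
  proof (rule rotation_maximum_vanish)
    fix c s :: real and e assume *: "c\<^sup>2 + s\<^sup>2 = 1" "cmod e = 1"
    show "s\<^sup>2 * (c' - b') + 2 * c * s * Im (z * cnj e) \<le> 0"
      using max'[OF rot_SU3(3)[OF *]] that
      by (simp add: height_rot[OF *]) (simp add: mat3_eq_iff mult3_nth rot23_def)
  qed
  ultimately show thesis using off K' tr gS cH by (intro that[of g a' b' c']) auto
qed

section \<open>Classification\<close>

locale subalg =
  fixes w :: "cmat3 set"
  assumes nonzero_proper: "nonzero_proper_subalgebra w"
begin

lemma subspace_w: "subspace w" and subset_su3: "w \<subseteq> su3"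
  and br: "A \<in> w \<Longrightarrow> B \<in> w \<Longrightarrow> lie_bracket A B \<in> w" and proper: "w \<noteq> su3"
  using nonzero_proper by (auto simp: nonzero_proper_subalgebra_def lie_subalgebra_def)

lemma add: "ms a b c x y z \<in> w \<Longrightarrow> ms a' b' c' x' y' z' \<in> w \<Longrightarrow>
    ms (a + a') (b + b') (c + c') (x + x') (y + y') (z + z') \<in> w"
  using subspace_add[OF subspace_w, of "ms a b c x y z" "ms a' b' c' x' y' z'"] by simp

lemma scale: "ms a b c x y z \<in> w \<Longrightarrow>
    ms (k * a) (k * b) (k * c) (of_real k * x) (of_real k * y) (of_real k * z) \<in> w"
  using subspace_scale[OF subspace_w, of "ms a b c x y z" k] by simp

lemma bracket: "ms a b c x y z \<in> w \<Longrightarrow> ms a' b' c' x' y' z' \<in> w \<Longrightarrow>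
   ms (2 * Im (x' * cnj x + y' * cnj y)) (2 * Im (z' * cnj z - x' * cnj x))
      (- 2 * Im (y' * cnj y + z' * cnj z))
      (\<i> * (a - b) * x' - \<i> * (a' - b') * x - y * cnj z' + y' * cnj z)
      (\<i> * (a - c) * y' - \<i> * (a' - c') * y + x * z' - x' * z)
      (\<i> * (b - c) * z' - \<i> * (b' - c') * z - cnj x * y' + cnj x' * y) \<in> w"
  using br[of "ms a b c x y z" "ms a' b' c' x' y' z'"] by simp

lemma trace0: "ms a b c x y z \<in> w \<Longrightarrow> a + b + c = 0"
  using subset_su3 by (auto dest: subsetD)

text \<open>The element of \<open>w\<close> is \<open>((ad H)\<^sup>2 + k) A\<close>.\<close>

lemma ad2:
  assumes "ms a b c 0 0 0 \<in> w" "ms a' b' c' x y z \<in> w"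
  shows "ms (k * a') (k * b') (k * c') (of_real (k - (a - b)\<^sup>2) * x)
    (of_real (k - (a - c)\<^sup>2) * y) (of_real (k - (b - c)\<^sup>2) * z) \<in> w"
proof -
  have "ms 0 0 0 (- of_real ((a - b)\<^sup>2) * x) (- of_real ((a - c)\<^sup>2) * y) (- of_real ((b - c)\<^sup>2) * z) \<in> w"
    using bracket[OF assms(1) bracket[OF assms]] 
    by (simp add: power2_eq_square algebra_simps)
  from add[OF scale[OF assms(2), of k] this] show ?thesis
    by (simp add: algebra_simps)
qed

lemma unscale:
  assumes "ms (k * a) (k * b) (k * c) (of_real k * x) (of_real k * y) (of_real k * z) \<in> w" "k \<noteq> 0"
  shows "ms a b c x y z \<in> w"
  using scale[OF assms(1), of "1 / k"] assms(2) by simp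

text \<open>If all nonzero entries have the same weight k, then ad H acts on them as multiplication
  by i k. Real combinations with the identity give all complex multiples.\<close>

lemma cmult:
  assumes "ms a b c 0 0 0 \<in> w" "ms 0 0 0 x y z \<in> w"
    and "x = 0 \<or> a - b = k" "y = 0 \<or> a - c = k" "z = 0 \<or> b - c = k" "k \<noteq> 0"
  shows "ms 0 0 0 (u * x) (u * y) (u * z) \<in> w"
proof -
  have "ms 0 0 0 (of_real k * (\<i> * x)) (of_real k * (\<i> * y)) (of_real k * (\<i> * z)) \<in> w"
    using bracket[OF assms(1,2)] assms(3-5) by (auto simp: algebra_simps simp flip: of_real_diff)
  then have "ms 0 0 0 (\<i> * x) (\<i> * y) (\<i> * z) \<in> w"
    using unscale[of k 0 0 0] assms(6) by simp
  from add[OF scale[OF assms(2), of "Re u"] scale[OF this, of "Im u"]]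
  have "ms 0 0 0 ((Re u + \<i> * Im u) * x) ((Re u + \<i> * Im u) * y) ((Re u + \<i> * Im u) * z) \<in> w"
    by (simp add: algebra_simps)
  then show ?thesis by (simp flip: complex_eq)
qed

section \<open>Subalgebras containing all diagonal elements\<close>

lemma classify_rank2:
  assumes w2: "w2 \<subseteq> w"
  shows "w \<sim> w2 \<or> w \<sim> w4"
proof -
  have dg: "ms a b c 0 0 0 \<in> w" if "a + b + c = 0" for a b c
    using w2 that by (auto simp: ms_mem_w subset_iff)
  have proj: "ms 0 0 0 x 0 0 \<in> w \<and> ms 0 0 0 0 y 0 \<in> w \<and> ms 0 0 0 0 0 z \<in> w"
    if A: "ms a b c x y z \<in> w" for a b c x y z
  proof -
    \<comment> \<open>The gaps are 1, 3 and 2 for x, y and z, so the squares 1, 9 and 4 are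
      distinct. Killing two of the three entries leaves the factors 24, 40 and -15.\<close>
    have D: "ms (4/3) (1/3) (-5/3) 0 0 0 \<in> w" using dg by simp
    have "ms (- a) (- b) (- c) 0 0 0 \<in> w" using trace0[OF A] by (intro dg) simp
    from add[OF A this] have o: "ms 0 0 0 x y z \<in> w" by simp
    have "ms 0 0 0 (of_real 24 * x) 0 0 \<in> w"
      using ad2[OF D ad2[OF D o, of 4], of 9] by (simp add: power2_eq_square)
    moreover have "ms 0 0 0 0 (of_real 40 * y) 0 \<in> w"
      using ad2[OF D ad2[OF D o, of 1], of 4] by (simp add: power2_eq_square)
    moreover have "ms 0 0 0 0 0 (of_real (-15) * z) \<in> w"
      using ad2[OF D ad2[OF D o, of 1], of 9] by (simp add: power2_eq_square)
    ultimately show ?thesis 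
      using unscale[of 24 0 0 0 x 0 0] unscale[of 40 0 0 0 0 y 0] unscale[of "-15" 0 0 0 0 0 z]
      by simp
  qed
  have cx: "ms 0 0 0 x' 0 0 \<in> w" if "ms 0 0 0 x 0 0 \<in> w" "x \<noteq> 0" for x x'
    using cmult[OF dg that(1), of 1 "-1" 0 2 "x'/x"] that by simp
  have cy: "ms 0 0 0 0 y' 0 \<in> w" if "ms 0 0 0 0 y 0 \<in> w" "y \<noteq> 0" for y y'
    using cmult[OF dg that(1), of 1 0 "-1" 2 "y'/y"] that by simp
  have cz: "ms 0 0 0 0 0 z' \<in> w" if "ms 0 0 0 0 0 z \<in> w" "z \<noteq> 0" for z z'
    using cmult[OF dg that(1), of 0 1 "-1" 2 "z'/z"] that by simp
  \<comment> \<open>By \<open>cx\<close>, \<open>cy\<close> and \<open>cz\<close> each root plane is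
    contained in \<open>w\<close> entirely or meets it only in zero, so three truth values describe
    \<open>w\<close>.\<close>
  define X where "X \<longleftrightarrow> (\<exists>x. x \<noteq> 0 \<and> ms 0 0 0 x 0 0 \<in> w)"
  define Y where "Y \<longleftrightarrow> (\<exists>y. y \<noteq> 0 \<and> ms 0 0 0 0 y 0 \<in> w)"
  define Z where "Z \<longleftrightarrow> (\<exists>z. z \<noteq> 0 \<and> ms 0 0 0 0 0 z \<in> w)"
  have mem: "ms a b c x y z \<in> w \<longleftrightarrow> a + b + c = 0 \<and> (X \<or> x = 0) \<and> (Y \<or> y = 0) \<and> (Z \<or> z = 0)"
    for a b c x y z
  proof
    assume "ms a b c x y z \<in> w"
    then show "a + b + c = 0 \<and> (X \<or> x = 0) \<and> (Y \<or> y = 0) \<and> (Z \<or> z = 0)"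
      using proj trace0 unfolding X_def Y_def Z_def by meson
  next
    assume *: "a + b + c = 0 \<and> (X \<or> x = 0) \<and> (Y \<or> y = 0) \<and> (Z \<or> z = 0)"
    have 0: "ms 0 0 0 0 0 0 \<in> w" using dg by simp
    have "ms 0 0 0 x 0 0 \<in> w" "ms 0 0 0 0 y 0 \<in> w" "ms 0 0 0 0 0 z \<in> w"
      using * cx cy cz 0 unfolding X_def Y_def Z_def by metis+
    from add[OF add[OF add[OF dg this(1)] this(2)] this(3)] *
    show "ms a b c x y z \<in> w" by simp
  qed
  have XY: "Z" if X Y using bracket[of 0 0 0 1 0 0 0 0 0 0 1 0] that by (simp add: mem)
  have XZ: "Y" if X Z using bracket[of 0 0 0 1 0 0 0 0 0 0 0 1] that by (simp add: mem)
  have YZ: "X" if Y Z using bracket[of 0 0 0 0 1 0 0 0 0 0 0 1] that by (simp add: mem)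
  have ext: "w = v" if "v \<subseteq> su3" 
    "\<And>a b c x y z. a + b + c = 0 \<Longrightarrow> ms a b c x y z \<in> w \<longleftrightarrow> ms a b c x y z \<in> v" for v
    using that subset_su3 by (auto simp: su3_eq subset_iff)
  have notall: "\<not> (X \<and> Y \<and> Z)"
    using ext[of su3] proper by (auto simp: mem)
  have conj4: "w \<sim> w4" if "g \<in> SU3" "\<And>A. A \<in> su3 \<Longrightarrow> cj g A \<in> w4 \<longleftrightarrow> A \<in> w" for g
  proof -
    have "cj g ` w = w4"
    proof (intro equalityI subsetI)
      fix A assume "A \<in> cj g ` w" then show "A \<in> w4" using subset_su3 that by auto
    next
      fix A assume A: "A \<in> w4"
      then have "cj (adj g) A \<in> su3" using w_subset_su3 cj_su3 SU3_adj that(1) by blast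
      then have "cj (adj g) A \<in> w" using that A by (metis cj_adj_cj(2))
      then show "A \<in> cj g ` w" by (metis cj_adj_cj(2) that(1) imageI)
    qed
    then show ?thesis using conjugate_cj[OF that(1)] by metis
  qed
  \<comment> \<open>At most one root plane is left. The swaps carry the planes of x and z to that of
    y, where the algebra becomes \<open>w4\<close>.\<close>
  consider "\<not> X" "\<not> Y" "\<not> Z" | "X" "\<not> Y" "\<not> Z" | "\<not> X" "Y" "\<not> Z" | "\<not> X" "\<not> Y" "Z"
    using notall XY XZ YZ by blast
  then show ?thesis
  proof cases
    case 1
    then have "w = w2" by (intro ext) (auto simp: w_subset_su3 mem ms_mem_w)
    then show ?thesis using conjugate_cj[of "mat 1" w2] by (simp add: SU3_def cj_def)
  next
    case 2
    then show ?thesis by (intro disjI2 conj4[OF swap_SU3(2)]) (auto simp: su3_eq cj_swap mem ms_mem_w)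
  next
    case 3
    have "w = w4" by (intro ext) (use 3 in \<open>auto simp: w_subset_su3 mem ms_mem_w\<close>)
    then show ?thesis using conjugate_cj[of "mat 1" w4] by (simp add: SU3_def cj_def)
  next
    case 4
    then show ?thesis by (intro disjI2 conj4[OF swap_SU3(1)]) (auto simp: su3_eq cj_swap mem ms_mem_w)
  qed
qed

end

section \<open>Subalgebras in which a sorted diagonal element spans its own centralizer\<close>

lemma classify_rank1:
  assumes "subalg w" and H: "ms a b c 0 0 0 \<in> w" and nz: "ms a b c 0 0 0 \<noteq> 0"
    and sorted: "b \<le> a" "c \<le> b"
    and one: "\<And>K. K \<in> w \<Longrightarrow> lie_bracket (ms a b c 0 0 0) K = 0 \<Longrightarrow> K \<in> span {ms a b c 0 0 0}"
  shows "(\<exists>l. w \<sim> w1 l) \<or> w \<sim> w31 \<or> w \<sim> w32"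
proof -
  interpret subalg w by fact
  let ?H = "ms a b c 0 0 0"
  have tr: "a + b + c = 0" using trace0[OF H] .
  have ac: "a > c" "a > 0" "c < 0" using sorted tr nz by (auto simp: ms_0)
  have Hs: "ms (k * a) (k * b) (k * c) 0 0 0 \<in> w" for k using scale[OF H, of k] by simp
  have refl: "w \<sim> w" for w using conjugate_cj[of "mat 1" w] by (simp add: SU3_def cj_def)
  have one': "\<exists>k. a' = k * a \<and> b' = k * b \<and> c' = k * c \<and> x = 0 \<and> y = 0 \<and> z = 0"
    if "ms a' b' c' x y z \<in> w" "a = b \<or> x = 0" "a = c \<or> y = 0" "b = c \<or> z = 0" for a' b' c' x y z
  proof -
    have "lie_bracket ?H (ms a' b' c' x y z) = 0" using that(2-4) by (auto simp: ms_0)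
    from one[OF that(1) this] show ?thesis by (auto simp: span_singleton)
  qed
  have off: "\<exists>k. a' = k * a \<and> b' = k * b \<and> c' = k * c \<and> ms 0 0 0 x y z \<in> w \<and>
      (a = b \<longrightarrow> x = 0) \<and> (b = c \<longrightarrow> z = 0)"
    if A: "ms a' b' c' x y z \<in> w" for a' b' c' x y z
  proof -
    let ?p = "(a - b)\<^sup>2" let ?q = "(b - c)\<^sup>2" let ?r = "(a - c)\<^sup>2"
    \<comment> \<open>A vanishing squared gap is replaced by 1. The cubic polynomial in (ad H)^2
      then kills every entry of nonzero weight but scales the diagonal by a nonzero factor, and what
      remains commutes with H.\<close>
    define p q where "p = (if a = b then 1 else ?p)" and "q = (if b = c then 1 else ?q)"
    have pq: "p \<noteq> 0" "q \<noteq> 0" by (auto simp: p_def q_def)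
    let ?x = "of_real ((p - ?p) * (q - ?p) * (?r - ?p)) * x"
    let ?z = "of_real ((p - ?q) * (q - ?q) * (?r - ?q)) * z"
    have "ms (p * q * ?r * a') (p * q * ?r * b') (p * q * ?r * c') ?x 0 ?z \<in> w"
      using ad2[OF H ad2[OF H ad2[OF H A, of p], of q], of ?r] by (simp add: mult_ac)
    moreover have "p * q * ?r \<noteq> 0" using pq ac by simp
    ultimately have *: "ms a' b' c' (?x / of_real (p * q * ?r)) 0 (?z / of_real (p * q * ?r)) \<in> w"
      using unscale[of "p * q * ?r" a' b' c' "?x / of_real (p * q * ?r)" 0 "?z / of_real (p * q * ?r)"] by simp
    have "\<exists>k. a' = k * a \<and> b' = k * b \<and> c' = k * c \<and> ?x / of_real (p * q * ?r) = 0 \<and> (0::complex) = 0 \<and> ?z / of_real (p * q * ?r) = 0"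
      by (rule one'[OF *]) (auto simp: p_def q_def)
    then obtain k where k: "a' = k * a" "b' = k * b" "c' = k * c" by blast
    have o: "ms 0 0 0 x y z \<in> w" using add[OF A Hs[of "- k"]] by (simp add: k)
    \<comment> \<open>Now the gaps of y and z coincide, so one application kills both and keeps x,
      leaving an element that commutes with H.\<close>
    have "x = 0" if "a = b"
      using one'[OF ad2[OF H o, of ?r]] that ac by auto
    moreover have "z = 0" if "b = c"
      using one'[OF ad2[OF H o, of ?r]] that ac by auto
    ultimately show ?thesis using k o by blast
  qed
  have dc: "\<exists>k. (a - b) * (cmod x)\<^sup>2 + (a - c) * (cmod y)\<^sup>2 = k * a \<and>
      (b - c) * (cmod z)\<^sup>2 - (a - b) * (cmod x)\<^sup>2 = k * b \<and>
      - (a - c) * (cmod y)\<^sup>2 - (b - c) * (cmod z)\<^sup>2 = k * c \<and>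
      (a = b \<longrightarrow> y * cnj z = 0) \<and> (b = c \<longrightarrow> x * cnj y = 0)"
    if A: "ms 0 0 0 x y z \<in> w" for x y z
  proof -
    have n: "(cmod u)\<^sup>2 = Re u * Re u + Im u * Im u" for u by (simp add: cmod_def power2_eq_square)
    \<comment> \<open>This is [A, [H, A]]. Its diagonal is twice the claimed triple, which accounts
      for k / 2 below.\<close>
    note off[OF bracket[OF A bracket[OF H A]]]
    then obtain k where k: "2 * ((a - b) * (cmod x)\<^sup>2 + (a - c) * (cmod y)\<^sup>2) = k * a"
      "2 * ((b - c) * (cmod z)\<^sup>2 - (a - b) * (cmod x)\<^sup>2) = k * b"
      "2 * (- (a - c) * (cmod y)\<^sup>2 - (b - c) * (cmod z)\<^sup>2) = k * c"
      and e: "a = b \<Longrightarrow> y * cnj z = 0" "b = c \<Longrightarrow> x * cnj y = 0"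
      using ac by (auto simp: n algebra_simps)
    show ?thesis by (rule exI[of _ "k / 2"]) (use k e in auto)
  qed
  \<comment> \<open>Here [A, [H, A]] has third diagonal entry zero while c < 0, so it is the zero
    multiple of H, against its nonzero first entry. For a lone z the argument is the same with a >
    0.\<close>
  have xonly: "x = 0" if A: "ms 0 0 0 x 0 0 \<in> w" for x
  proof (rule ccontr)
    assume x: "x \<noteq> 0"
    with that off have "a > b" using sorted by force
    moreover obtain k where "(a - b) * (cmod x)\<^sup>2 + (a - c) * (cmod 0)\<^sup>2 = k * a"
      "- (a - c) * (cmod 0)\<^sup>2 - (b - c) * (cmod 0)\<^sup>2 = k * c"
      using dc[OF A] by blast
    ultimately show False using x ac by auto
  qed
  have zonly: "z = 0" if A: "ms 0 0 0 0 0 z \<in> w" for z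
  proof (rule ccontr)
    assume z: "z \<noteq> 0"
    with that off have "b > c" using sorted by force
    moreover obtain k where "(a - b) * (cmod 0)\<^sup>2 + (a - c) * (cmod 0)\<^sup>2 = k * a"
      "(b - c) * (cmod z)\<^sup>2 - (a - b) * (cmod 0)\<^sup>2 = k * b"
      using dc[OF A] by blast
    ultimately show False using z ac by auto
  qed
  have only_H: "w = span {?H}" if "\<And>x y z. ms 0 0 0 x y z \<in> w \<Longrightarrow> x = 0 \<and> y = 0 \<and> z = 0"
  proof
    show "span {?H} \<subseteq> w" using H subspace_w by (simp add: span_minimal)
    show "w \<subseteq> span {?H}"
    proof
      fix A assume A: "A \<in> w"
      then obtain a' b' c' x y z where *: "A = ms a' b' c' x y z" using subset_su3 by (auto simp: su3_eq)
      then show "A \<in> span {?H}" using off[of a' b' c' x y z] that A by (force simp: span_singleton)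
    qed
  qed
  have w1: "\<exists>l. w \<sim> w1 l" if "w = span {?H}"
  proof -
    have "b = a * (- c / a - 1)" using tr ac by (simp add: right_diff_distrib)
    then have "span {?H} = w1 (- c / a)"
      using ac by (intro span_diag_eq_w1[of a]) auto
    then show ?thesis using that refl by metis
  qed
  show ?thesis
  \<comment> \<open>As the trace is zero, equal gaps mean b = 0, so that H is proportional to
    diag(i, 0, -i).\<close>
  proof (cases "a - b = b - c")
    case False
    have "x = 0 \<and> y = 0 \<and> z = 0" if A: "ms 0 0 0 x y z \<in> w" for x y z
    proof -
      have ab: "a = b \<longrightarrow> x = 0" "b = c \<longrightarrow> z = 0" using off[OF A] by auto
      let ?p = "(a - b)\<^sup>2" let ?q = "(b - c)\<^sup>2" let ?r = "(a - c)\<^sup>2"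
      have ne: "?p \<noteq> ?q" using False sorted by (simp add: power2_eq_iff_nonneg)
      have "x = 0"
      proof (rule ccontr)
        assume x: "x \<noteq> 0"
        show False
        proof (cases "b = c")
          case True
          \<comment> \<open>The gaps of x and y coincide and cannot be separated, but
            \<open>dc\<close> gives y = 0 and \<open>ab\<close> gives z = 0.\<close>
          then show False using dc[OF A] ab x xonly A by auto
        next
          case b: False
          then have "?r \<noteq> ?p" using sorted ac by (simp add: power2_eq_iff_nonneg)
          then have "of_real (?q - ?p) \<noteq> (0::complex)" "of_real (?r - ?p) \<noteq> (0::complex)"
            using ne by (simp_all del: of_real_diff of_real_power)
          moreover have "of_real (?q - ?p) * (of_real (?r - ?p) * x) = 0"
            using ad2[OF H ad2[OF H A, of ?r], of ?q] by (intro xonly) simp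
          ultimately show False using x by (simp only: mult_eq_0_iff simp_thms)
        qed
      qed
      moreover have "z = 0"
      proof (rule ccontr)
        assume z: "z \<noteq> 0"
        show False
        proof (cases "a = b")
          case True
          then show False using dc[OF A] ab z zonly A by auto
        next
          case b: False
          then have "?r \<noteq> ?q" using sorted ac by (simp add: power2_eq_iff_nonneg)
          then have "of_real (?p - ?q) \<noteq> (0::complex)" "of_real (?r - ?q) \<noteq> (0::complex)"
            using ne by (simp_all del: of_real_diff of_real_power)
          moreover have "of_real (?p - ?q) * (of_real (?r - ?q) * z) = 0"
            using ad2[OF H ad2[OF H A, of ?r], of ?p] by (intro zonly) simp
          ultimately show False using z by (simp only: mult_eq_0_iff simp_thms)
        qed
      qed
      \<comment> \<open>With x = z = 0 the middle entry reads k b = 0 with k nonzero; then b = 0 and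
        the gaps would be equal.\<close>
      moreover have "y = 0"
      proof (rule ccontr)
        assume y: "y \<noteq> 0"
        obtain k where k: "(a - b) * (cmod x)\<^sup>2 + (a - c) * (cmod y)\<^sup>2 = k * a"
          "(b - c) * (cmod z)\<^sup>2 - (a - b) * (cmod x)\<^sup>2 = k * b"
          using dc[OF A] by blast
        note k = k[unfolded \<open>x = 0\<close> \<open>z = 0\<close>, simplified]
        then have "k \<noteq> 0" using y ac by auto
        then show False using k False tr by auto
      qed
      ultimately show ?thesis by blast
    qed
    then show ?thesis using w1 only_H by blast
  next
    case True
    then have b: "b = 0" and c: "c = - a" using tr by auto
    have D: "ms 1 0 (- 1) 0 0 0 \<in> w" using Hs[of "1 / a"] ac by (simp add: b c)
    have Da: "ms k 0 (- k) 0 0 0 \<in> w" for k using scale[OF D, of k] by simp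
    \<comment> \<open>Under ad D the entries x and z have weight 1 and y has weight 2, so
      subtracting the squares 1 and 4 separates them.\<close>
    have y: "ms 0 0 0 0 y 0 \<in> w" and xz: "ms 0 0 0 x 0 z \<in> w" if A: "ms 0 0 0 x y z \<in> w" for x y z
      using ad2[OF D A, of 1] ad2[OF D A, of 4] unscale[of "- 3" 0 0 0 0 y 0] unscale[of 3 0 0 0 x 0 z] by simp_all
    have cy: "ms 0 0 0 0 (u * y) 0 \<in> w" if "ms 0 0 0 0 y 0 \<in> w" for u y
      using cmult[OF D that, of 2 u] by simp
    have cxz: "ms 0 0 0 (u * x) 0 (u * z) \<in> w" if "ms 0 0 0 x 0 z \<in> w" for u x z
      using cmult[OF D that, of 1 u] by simp
    have eq: "cmod x = cmod z" if "ms 0 0 0 x 0 z \<in> w" for x z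
    proof -
      from dc[OF that] have "a * (cmod z)\<^sup>2 = a * (cmod x)\<^sup>2" by (auto simp: b c)
      then show ?thesis using ac by simp
    qed
    have form: "\<exists>k x y z. A = ms k 0 (- k) x y z \<and> ms 0 0 0 0 y 0 \<in> w \<and> ms 0 0 0 x 0 z \<in> w" if A: "A \<in> w" for A
    proof -
      from A obtain a' b' c' x y z where *: "A = ms a' b' c' x y z" using subset_su3 by (auto simp: su3_eq)
      then obtain k where "a' = k * a" "b' = 0" "c' = - (k * a)" "ms 0 0 0 x y z \<in> w"
        using off[of a' b' c' x y z] A by (auto simp: b c)
      then show ?thesis using * y xz by blast
    qed
    show ?thesis
    proof (cases "\<exists>y. y \<noteq> 0 \<and> ms 0 0 0 0 y 0 \<in> w")
      case True
      then have Y: "ms 0 0 0 0 y 0 \<in> w" for y by (metis cy nonzero_divide_eq_eq)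
      have X: "x = 0 \<and> z = 0" if A: "ms 0 0 0 x 0 z \<in> w" for x z
      proof -
        have e: "cmod x = cmod z" using eq[OF A] .
        \<comment> \<open>Bracketing A with an element of the y plane, and A with the result,
          produces a middle diagonal entry proportional to this imaginary part. It vanishes because
          b = 0.\<close>
        have "Im (u * cnj z * cnj x) = 0" for u
        proof -
          have "ms 0 0 0 (u * cnj z) 0 (- cnj x * u) \<in> w"
            using bracket[OF A Y[of "- u"]] bracket[OF A Y[of "u"]] by (simp add: algebra_simps)
          from off[OF bracket[OF A this]] show ?thesis 
            by (auto simp: b c) (simp add: algebra_simps)
        qed
        from this[of 1] this[of \<i>] have "cnj z * cnj x = 0" by (simp add: complex_eq_iff)
        then show ?thesis using e by auto
      qed
      have "w = w31"
      proof (intro equalityI subsetI)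
        fix A assume "A \<in> w" 
        then obtain k x y z where "A = ms k 0 (- k) x y z" "ms 0 0 0 x 0 z \<in> w"
          using form by blast
        then show "A \<in> w31" using X by (auto simp: ms_mem_w)
      next
        fix A assume "A \<in> w31" 
        then obtain k y where A: "A = ms k 0 (- k) 0 y 0" by (auto simp: w_eq_range_param param31_def)
        show "A \<in> w" using add[OF Da[of k] Y[of y]] by (simp add: A)
      qed
      then show ?thesis using refl by auto
    next
      case noy: False
      show ?thesis
      proof (cases "\<exists>x z. ms 0 0 0 x 0 z \<in> w \<and> x \<noteq> 0")
        case False
        have "x = 0 \<and> y = 0 \<and> z = 0" if "ms 0 0 0 x y z \<in> w" for x y z
          using False noy eq[OF xz[OF that]] y[OF that] xz[OF that] by auto
        then show ?thesis using w1 only_H by blast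
      next
        case True
        then obtain x0 z0 where A: "ms 0 0 0 x0 0 z0 \<in> w" "x0 \<noteq> 0" by auto
        define v where "v = z0 / x0"
        have v: "cmod v = 1" unfolding v_def norm_divide eq[OF A(1), symmetric] using A(2) by simp
        have V: "ms 0 0 0 x 0 (v * x) \<in> w" for x using cxz[OF A(1), of "x / x0"] A(2) by (simp add: v_def mult_ac)
        \<comment> \<open>Another ratio would leave an element with only a z entry, which
          \<open>zonly\<close> excludes.\<close>
        have V': "z = v * x" if "ms 0 0 0 x 0 z \<in> w" for x z
        proof -
          have "ms 0 0 0 0 0 (z - v * x) \<in> w" using add[OF that V[of "- x"]] by simp
          from zonly[OF this] show ?thesis by simp
        qed
        \<comment> \<open>Conjugation by diag(s, s^-2, s) multiplies x by s^3 and z by s^-3.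
          Equalizing x and v x therefore requires s^6 = v.\<close>
        define s where "s = cis (Arg v / 6)"
        have s: "s ^ 6 = v" "s * cnj s = 1"
        proof -
          have "v \<noteq> 0" using v by auto
          then have "cis (Arg v) = v" using v by (simp add: cis_Arg sgn_div_norm)
          moreover have "s ^ 6 = cis (real 6 * (Arg v / 6))" unfolding s_def by (rule Complex.DeMoivre)
          moreover have "real 6 * (Arg v / 6) = Arg v" by simp
          ultimately show "s ^ 6 = v" by metis
        qed (simp add: s_def cis_mult cis_cnj)
        define g where "g = (vector [vector [s, 0, 0], vector [0, (cnj s)^2, 0], vector [0, 0, s]] :: cmat3)"
        have g: "g \<in> SU3"
          using s(2) by (simp add: g_def SU3_def mat3_eq_iff mult3_nth mat_def det_3 power2_eq_square mult_ac) algebra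
        have cg: "cj g (ms k 0 (- k) x 0 z) = ms k 0 (- k) (s^3 * x) 0 ((cnj s)^3 * z)" for k x z
        proof -
          have "s * of_real k * cnj s = k" using s(2) by algebra
          then show ?thesis
            by (simp add: cj_def g_def mat3_eq_iff mult3_nth power2_eq_square power3_eq_cube mult_ac)
        qed
        have sv: "(cnj s)^3 * v = s^3"
        proof -
          have "(cnj s)^3 * s^6 = s^3 * (s * cnj s)^3" by (simp add: eval_nat_numeral mult_ac)
          then show ?thesis unfolding s by simp
        qed
        have svx: "(cnj s)^3 * (v * x) = s^3 * x" for x
          by (metis sv mult.assoc)
        have s0: "s \<noteq> 0" using s(2) by auto
        have "cj g ` w = w32"
        proof (intro equalityI subsetI)
          fix B assume "B \<in> cj g ` w"
          then obtain A where A: "A \<in> w" "B = cj g A" by blast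
          then obtain k x y z where K: "A = ms k 0 (- k) x y z" "ms 0 0 0 0 y 0 \<in> w" "ms 0 0 0 x 0 z \<in> w"
            using form by blast
          have "y = 0" using noy K(2) by auto
          with V'[OF K(3)] show "B \<in> w32" by (simp add: A(2) K(1) cg ms_mem_w svx)
        next
          fix B assume "B \<in> w32"
          then obtain k x where B: "B = ms k 0 (- k) x 0 x" by (auto simp: w_eq_range_param param32_def)
          have "ms k 0 (- k) (x / s^3) 0 (v * (x / s^3)) \<in> w"
            using add[OF Da[of k] V[of "x / s^3"]] by simp
          moreover have "B = cj g (ms k 0 (- k) (x / s^3) 0 (v * (x / s^3)))"
            using s0 by (simp only: B cg svx) simp
          ultimately show "B \<in> cj g ` w" by blast
        qed
        then show ?thesis using conjugate_cj[OF g, of w] by auto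
      qed
    qed
  qed
qed

section \<open>Reduction of an arbitrary subalgebra to the two cases\<close>

lemma classification:
  assumes w: "nonzero_proper_subalgebra w"
  shows "(\<exists>l. w \<sim> w1 l) \<or> w \<sim> w2 \<or> w \<sim> w31 \<or> w \<sim> w32 \<or> w \<sim> w4"
proof -
  have subspace_w: "subspace w" and subset_su3: "w \<subseteq> su3" and nz: "w \<noteq> {0}"
    using w by (auto simp: nonzero_proper_subalgebra_def lie_subalgebra_def)
  obtain H where H: "H \<in> w" "H \<noteq> 0" using nz subspace_0[OF subspace_w] by auto
  \<comment> \<open>Commuting with zero is no restriction, so this only diagonalizes H and sorts its
    eigenvalues.\<close>
  have "lie_bracket (ms 0 0 0 0 0 0) H = 0"
    unfolding ms_0[symmetric] by (simp add: lie_bracket_def mat3_eq_iff mult3_nth)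
  moreover have "H \<in> su3" using subset_su3 H by blast
  ultimately obtain g a b c where g: "g \<in> SU3" and gH: "cj g H = ms a b c 0 0 0"
    and ab: "b \<le> a" "c \<le> b"
    by (metis diagonalize_commuting)
  let ?w = "cj g ` w" let ?H = "ms a b c 0 0 0"
  have wg: "w \<sim> ?w" using conjugate_cj g by blast
  have npg: "nonzero_proper_subalgebra ?w" using nonzero_proper_subalgebra_cj g w by blast
  interpret subalg ?w by unfold_locales (rule npg)
  have Hw: "?H \<in> ?w" using H gH by force
  have H0: "?H \<noteq> 0" using H gH inj_cj[OF g] linear_0[OF linear_cj[of g]] by (metis injD)
  show ?thesis
  proof (cases "\<forall>K\<in>?w. lie_bracket ?H K = 0 \<longrightarrow> K \<in> span {?H}")
    case True
    have "subalg ?w" by unfold_locales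
    from classify_rank1[OF this Hw H0 ab] True
    show ?thesis using conjugate_trans[OF wg] by blast
  next
    case False
    then obtain K where K: "K \<in> ?w" "lie_bracket ?H K = 0" "K \<notin> span {?H}" by blast
    obtain h a' b' c' where h: "h \<in> SU3" and hH: "cj h ?H = ?H"
      and hK: "cj h K = ms a' b' c' 0 0 0"
      using diagonalize_commuting[OF subsetD[OF subset_su3 K(1)] K(2)] by metis
    let ?v = "cj h ` ?w"
    have vw: "w \<sim> ?v" using conjugate_trans[OF wg conjugate_cj[OF h]] .
    have npv: "nonzero_proper_subalgebra ?v" using nonzero_proper_subalgebra_cj h npg by blast
    then interpret v: subalg ?v by unfold_locales
    have Hv: "?H \<in> ?v" using Hw hH by force
    have Kv: "ms a' b' c' 0 0 0 \<in> ?v" using K hK by force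
    have nK: "ms a' b' c' 0 0 0 \<noteq> k *\<^sub>R ?H" for k
    proof
      assume "ms a' b' c' 0 0 0 = k *\<^sub>R ?H"
      then have "cj h K = cj h (k *\<^sub>R ?H)" by (metis hK hH linear_scale[OF linear_cj])
      then have "K = k *\<^sub>R ?H" using inj_cj[OF h] by (meson injD)
      then show False using K(3) by (auto simp: span_singleton simp del: ms_scaleR)
    qed
    have tr: "b = - a - c" "b' = - a' - c'" using v.trace0[OF Hv] v.trace0[OF Kv] by auto
    \<comment> \<open>A traceless diagonal matrix is determined by its outer entries, so
      independence of H and K is the nonvanishing of this determinant.\<close>
    have det: "a * c' - a' * c \<noteq> 0"
    proof
      assume d: "a * c' - a' * c = 0"
      show False
      proof (cases "a = 0")
        case True
        then have "c \<noteq> 0" using H0 tr by (auto simp: ms_0)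
        then show False using nK[of "c' / c"] d True tr by (auto simp: field_simps)
      next
        case False
        then show False using nK[of "a' / a"] d tr by (auto simp: field_simps)
      qed
    qed
    have "w2 \<subseteq> ?v"
    proof
      fix A assume "A \<in> w2"
      then obtain p q where A: "A = ms p (- p - q) q 0 0 0" by (auto simp: w_eq_range_param param2_def)
      define D where "D = a * c' - a' * c"
      \<comment> \<open>Cramer's rule for expressing A through the two diagonal elements.\<close>
      define s t where "s = (p * c' - a' * q) / D" and "t = (a * q - p * c) / D"
      have "D \<noteq> 0" using det by (simp add: D_def)
      have "s * a + t * a' = (p * D) / D" "s * c + t * c' = (q * D) / D"
        by (simp_all add: s_def t_def D_def algebra_simps flip: add_divide_distrib diff_divide_distrib)
      then have "s * a + t * a' = p" "s * c + t * c' = q" using \<open>D \<noteq> 0\<close> by auto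
      moreover from this have "s * b + t * b' = - p - q" by (simp add: tr algebra_simps)
      ultimately show "A \<in> ?v"
        using v.add[OF v.scale[OF Hv, of s] v.scale[OF Kv, of t]] by (simp add: A)
    qed
    from v.classify_rank2[OF this] show ?thesis using conjugate_trans[OF vw] by blast
  qed
qed

theorem theorem7p3:
  "(\<forall>l. nonzero_proper_subalgebra (w1 l) \<and> dim (w1 l) = 1) \<and>
   (nonzero_proper_subalgebra w2 \<and> dim w2 = 2) \<and>
   (nonzero_proper_subalgebra w31 \<and> dim w31 = 3) \<and>
   (nonzero_proper_subalgebra w32 \<and> dim w32 = 3) \<and>
   (nonzero_proper_subalgebra w4 \<and> dim w4 = 4) \<and>
   (\<forall>w. nonzero_proper_subalgebra w \<longrightarrow>
      (\<exists>l. w \<sim> w1 l) \<or> w \<sim> w2 \<or> w \<sim> w31 \<or> w \<sim> w32 \<or> w \<sim> w4) \<and>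
   (\<forall>l m. w1 l \<sim> w1 m \<longleftrightarrow>
      m = l \<or> m = 1 - l \<or> (l \<noteq> 0 \<and> m = 1 / l) \<or> (l \<noteq> 0 \<and> m = (l - 1) / l) \<or>
      (l - 1 \<noteq> 0 \<and> m = l / (l - 1)) \<or> (1 - l \<noteq> 0 \<and> m = 1 / (1 - l))) \<and>
   (\<forall>l. \<not> w1 l \<sim> w2 \<and> \<not> w1 l \<sim> w31 \<and> \<not> w1 l \<sim> w32 \<and> \<not> w1 l \<sim> w4) \<and>
   \<not> w2 \<sim> w31 \<and> \<not> w2 \<sim> w32 \<and> \<not> w2 \<sim> w4 \<and>
   \<not> w31 \<sim> w32 \<and> \<not> w31 \<sim> w4 \<and> \<not> w32 \<sim> w4"
proof (intro conjI allI impI)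
  fix l m
  show "w1 l \<sim> w1 m \<longleftrightarrow>
      m = l \<or> m = 1 - l \<or> (l \<noteq> 0 \<and> m = 1 / l) \<or> (l \<noteq> 0 \<and> m = (l - 1) / l) \<or>
      (l - 1 \<noteq> 0 \<and> m = l / (l - 1)) \<or> (1 - l \<noteq> 0 \<and> m = 1 / (1 - l))"
  proof
    assume "w1 l \<sim> w1 m"
    then obtain k where k: "k\<^sup>2 * (m\<^sup>2 - m + 1) = l\<^sup>2 - l + 1" "k^3 * (m\<^sup>2 - m) = l\<^sup>2 - l"
      by (rule conjugate_w1_invariants)
    show "m = l \<or> m = 1 - l \<or> (l \<noteq> 0 \<and> m = 1 / l) \<or> (l \<noteq> 0 \<and> m = (l - 1) / l) \<or>
      (l - 1 \<noteq> 0 \<and> m = l / (l - 1)) \<or> (1 - l \<noteq> 0 \<and> m = 1 / (1 - l))"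
      by (rule w1_parameter_cases[OF k])
  qed (rule w1_conjugateI)
next
  fix w assume "nonzero_proper_subalgebra w"
  then show "(\<exists>l. w \<sim> w1 l) \<or> w \<sim> w2 \<or> w \<sim> w31 \<or> w \<sim> w32 \<or> w \<sim> w4"
    by (rule classification)
qed (simp_all add: nonzero_proper_subalgebra_w dim_w not_conjugate_if_dim_neq not_conjugate_w31_w32)

end
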